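(* Let $q=p^m$ where $p$ is a prime and $m\geq 1$ is an integer, let $n\geq 2$ be an integer, and let $C$ be an extended $1$-perfect code in the Hamming graph $H(n,q)$. Then one of the following holds: (1) $n=2$; (2) $p=2$, $m=1$ and $n=2^t$ for some integer $t\geq 2$; (3) $p=2$, $m\geq 1$ and $n=q+2$.
   Context: The Hamming graph $H(n,q)$ has as vertices all words of length $n$ over the alphabet $\{0,1,\dots,q-1\}$, two words being adjacent iff they differ in exactly one coordinate. A code is a subset of the vertex set. A code $C$ in a graph $G$ is $1$-perfect if the vertex set of $G$ is partitioned by the balls of radius $1$ centered at the vertices of $C$. A code $C$ in $H(n,q)$ is an extended $1$-perfect code if deleting (puncturing) any single coordinate position from all codewords yields a $1$-perfect code in $H(n-1,q)$. *)

theory Defs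
  imports
    "Graph_Theory.Pair_Digraph"
    "HOL-Library.Disjoint_Sets"
    "HOL-Computational_Algebra.Primes"
begin

definition hamming_words :: "nat \<Rightarrow> nat \<Rightarrow> nat list set" where
  "hamming_words n q = {w. length w = n \<and> set w \<subseteq> {..<q}}"

definition hamming_graph :: "nat \<Rightarrow> nat \<Rightarrow> nat list pair_pre_digraph" where
  "hamming_graph n q =
    \<lparr> pverts = hamming_words n q,
      parcs = {(u, v). u \<in> hamming_words n q \<and> v \<in> hamming_words n q \<and>
                       card {i. i < n \<and> u ! i \<noteq> v ! i} = 1} \<rparr>"

(* Graph distance at most r, i.e. a walk with at most r edges.  A walk of the library
   is the list of its arcs, so length p counts edges. *)
definition graph_ball :: "'a pair_pre_digraph \<Rightarrow> nat \<Rightarrow> 'a \<Rightarrow> 'a set" where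
  "graph_ball G r u =
    {v \<in> pverts G. \<exists>p. pre_digraph.awalk (with_proj G) u p v \<and> length p \<le> r}"

(* Disjointness is required of the family of balls indexed by C, not of the set of balls:
   distinct vertices may have the same ball (e.g. in a complete graph), and then they
   must not both belong to C. *)
definition one_perfect_code :: "'a pair_pre_digraph \<Rightarrow> 'a set \<Rightarrow> bool" where
  "one_perfect_code G C \<longleftrightarrow>
    C \<subseteq> pverts G \<and> disjoint_family_on (graph_ball G 1) C \<and>
    (\<Union>c\<in>C. graph_ball G 1 c) = pverts G"

definition puncture :: "nat \<Rightarrow> 'a list \<Rightarrow> 'a list" where
  "puncture i w = take i w @ drop (Suc i) w"

(* The punctured code is the set of punctured codewords. *)
definition extended_one_perfect_code :: "nat \<Rightarrow> nat \<Rightarrow> nat list set \<Rightarrow> bool" where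
  "extended_one_perfect_code n q C \<longleftrightarrow>
    C \<subseteq> pverts (hamming_graph n q) \<and>
    (\<forall>i<n. one_perfect_code (hamming_graph (n - 1) q) (puncture i ` C))"

lemma finite_hamming_words: "finite (hamming_words n q)"
proof -
  have "hamming_words n q = {w. set w \<subseteq> {..<q} \<and> length w = n}"
    by (auto simp: hamming_words_def)
  then show ?thesis
    using finite_lists_length_eq[of "{..<q}" n] by simp
qed

lemma pair_graph_hamming_graph: "pair_graph (hamming_graph n q)"
proof
  have "parcs (hamming_graph n q) \<subseteq> hamming_words n q \<times> hamming_words n q"
    by (auto simp: hamming_graph_def)
  then show "finite (parcs (hamming_graph n q))"
    using finite_hamming_words finite_subset by blast
  show "finite (pverts (hamming_graph n q))"
    by (simp add: hamming_graph_def finite_hamming_words)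
  show "symmetric (with_proj (hamming_graph n q))"
    by (auto simp: symmetric_def sym_def hamming_graph_def eq_commute)
qed (auto simp: hamming_graph_def)

lemma graph_ball_1:
  assumes "u \<in> pverts G"
  shows "graph_ball G 1 u = {v \<in> pverts G. v = u \<or> (u, v) \<in> parcs G}"
proof (intro set_eqI iffI)
  fix v
  assume "v \<in> graph_ball G 1 u"
  then obtain p where v: "v \<in> pverts G" and p: "pre_digraph.awalk (with_proj G) u p v"
    and len: "length p \<le> 1"
    by (auto simp: graph_ball_def)
  from len consider "p = []" | e where "p = [e]"
    by (cases p) auto
  then show "v \<in> {v \<in> pverts G. v = u \<or> (u, v) \<in> parcs G}"
    using v p by cases (auto simp: pre_digraph.awalk_def cas_with_proj_eq)
next
  fix v
  assume v: "v \<in> {v \<in> pverts G. v = u \<or> (u, v) \<in> parcs G}"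
  then have "pre_digraph.awalk (with_proj G) u (if v = u then [] else [(u, v)]) v"
    using assms by (auto simp: pre_digraph.awalk_def cas_with_proj_eq)
  moreover have "length (if v = u then [] else [(u, v)]) \<le> 1"
    by simp
  ultimately show "v \<in> graph_ball G 1 u"
    using v unfolding graph_ball_def by blast
qed

end

theory Submission
  imports Defs "HOL-Library.Indicator_Function"
begin

text \<open>
  Let \<open>f\<close> be the indicator function of \<open>C\<close>, let \<open>L\<^sub>i\<close> be the operator that sums a function along
  the lines in direction \<open>i\<close>, and let \<open>A = (\<Sum>i. L\<^sub>i - 1)\<close> be the adjacency operator.  The
  \<open>1\<close>-perfectness of the punctured codes says that \<open>L\<^sub>j (A f) = 1 + (q - 2) L\<^sub>j f\<close> for all \<open>j\<close>.
  Applying the product of all \<open>L\<^sub>i\<close> shows that \<open>1 + (n - 1) (q - 1)\<close> divides \<open>q ^ n\<close>.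
  Moreover \<open>g = 1 + q (q - 2) f - q A f\<close> has sum zero on every line, so that the product
  \<open>\<Phi>\<close> of all \<open>L\<^sub>i - q\<close> satisfies \<open>\<Phi> g = (- q) ^ n g\<close>; on the other hand \<open>\<Phi> L\<^sub>i = 0\<close>
  gives \<open>\<Phi> g = q (n + q - 2) \<Phi> f\<close>.  Evaluating at a point with \<open>g = 1\<close>, that is at distance
  \<open>2\<close> from \<open>C\<close>, shows that \<open>n + q - 2\<close> divides \<open>q ^ n\<close> as well.  Hence both numbers are powers of
  \<open>p\<close>, which leaves only the listed parameters.
\<close>

section \<open>Line sums\<close>

definition line_sum :: "nat \<Rightarrow> nat \<Rightarrow> (nat list \<Rightarrow> int) \<Rightarrow> nat list \<Rightarrow> int" where
  "line_sum q i h y = (\<Sum>a<q. h (y[i := a]))"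

definition nbr_sum :: "nat \<Rightarrow> nat \<Rightarrow> (nat list \<Rightarrow> int) \<Rightarrow> nat list \<Rightarrow> int" where
  "nbr_sum n q h y = (\<Sum>i<n. line_sum q i h y - h y)"

text \<open>The product of the operators \<open>L\<^sub>i - t\<close> over \<open>i < k\<close>.
  With \<open>t = 0\<close> and \<open>k = n\<close> it gives, at any word of length
  \<open>n\<close>, the total of \<open>h\<close> over all words; with \<open>t = int q\<close> and
  \<open>k = n\<close> it is \<open>\<Phi>\<close>.\<close>

primrec line_op :: "nat \<Rightarrow> int \<Rightarrow> nat \<Rightarrow> (nat list \<Rightarrow> int) \<Rightarrow> nat list \<Rightarrow> int" where
  "line_op q t 0 h = h"
| "line_op q t (Suc k) h = (\<lambda>y. line_sum q k (line_op q t k h) y - t * line_op q t k h y)"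

section \<open>Algebra of the line operators\<close>

lemma line_sum_add: "line_sum q i (\<lambda>y. h y + h' y) y = line_sum q i h y + line_sum q i h' y"
  by (simp add: line_sum_def sum.distrib)

lemma line_sum_diff: "line_sum q i (\<lambda>y. h y - h' y) y = line_sum q i h y - line_sum q i h' y"
  by (simp add: line_sum_def sum_subtractf)

lemma line_sum_cmult: "line_sum q i (\<lambda>y. c * h y) y = c * line_sum q i h y"
  by (simp add: line_sum_def sum_distrib_left)

lemma line_sum_sum: "line_sum q i (\<lambda>y. \<Sum>j\<in>J. h j y) y = (\<Sum>j\<in>J. line_sum q i (h j) y)"
  unfolding line_sum_def by (rule sum.swap)

lemma line_sum_const: "line_sum q i (\<lambda>y. c) y = int q * c"
  by (simp add: line_sum_def)

lemma line_sum_idem: "line_sum q i (line_sum q i h) y = int q * line_sum q i h y"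
  by (simp add: line_sum_def)

lemma line_sum_commute: "line_sum q i (line_sum q j h) = line_sum q j (line_sum q i h)"
proof (cases "i = j")
  case False
  then have "y[i := a, j := b] = y[j := b, i := a]" for y :: "nat list" and a b
    by (simp add: list_update_swap)
  then show ?thesis
    by (auto simp: line_sum_def fun_eq_iff intro: sum.swap[THEN trans])
qed simp

lemma line_op_add: "line_op q t k (\<lambda>y. h y + h' y) = (\<lambda>y. line_op q t k h y + line_op q t k h' y)"
  by (induction k) (simp_all add: line_sum_add algebra_simps)

lemma line_op_diff: "line_op q t k (\<lambda>y. h y - h' y) = (\<lambda>y. line_op q t k h y - line_op q t k h' y)"
  by (induction k) (simp_all add: line_sum_diff algebra_simps)

lemma line_op_cmult: "line_op q t k (\<lambda>y. c * h y) = (\<lambda>y. c * line_op q t k h y)"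
  by (induction k) (simp_all add: line_sum_cmult algebra_simps)

lemma line_op_sum: "line_op q t k (\<lambda>y. \<Sum>j\<in>J. h j y) = (\<lambda>y. \<Sum>j\<in>J. line_op q t k (h j) y)"
  by (induction k) (simp_all add: line_sum_sum sum_subtractf sum_distrib_left)

lemma line_op_const: "line_op q t k (\<lambda>y. c) = (\<lambda>y. (int q - t) ^ k * c)"
  by (induction k) (simp_all add: line_sum_const algebra_simps)

lemma line_op_line_sum_commute: "line_op q t k (line_sum q i h) = line_sum q i (line_op q t k h)"
proof (induction k)
  case (Suc k)
  show ?case
    by (simp only: line_op.simps Suc.IH fun_eq_iff line_sum_diff line_sum_cmult line_sum_commute[of q k i])
      simp
qed simp

text \<open>Since \<open>L\<^sub>i\<close> squared is \<open>q\<close> times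
  \<open>L\<^sub>i\<close>, the factor \<open>L\<^sub>i - t\<close> of the product absorbs
  \<open>L\<^sub>i\<close> with factor \<open>q\<close> if \<open>t = 0\<close> and annihilates it
  if \<open>t = int q\<close>.\<close>

lemma line_op_line_sum:
  assumes "t = 0 \<or> t = int q" and "i < k"
  shows "line_op q t k (line_sum q i h) = (\<lambda>y. (int q - t) * line_op q t k h y)"
  using assms(2)
proof (induction k)
  case (Suc k)
  show ?case
  proof (cases "i < k")
    case True
    then show ?thesis
      by (simp only: line_op.simps Suc.IH fun_eq_iff line_sum_cmult) (simp add: algebra_simps)
  next
    case False
    with Suc.prems have "i = k" by simp
    then show ?thesis
      using assms(1)
      by (auto simp: fun_eq_iff line_op_line_sum_commute line_sum_idem line_sum_diff line_sum_cmult)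
  qed
qed simp

text \<open>Each \<open>L\<^sub>i\<close> in \<open>A\<close> becomes the scalar
  \<open>q - t\<close>. So \<open>A\<close> turns into its largest eigenvalue
  \<open>n (q - 1)\<close> for \<open>t = 0\<close> and into its smallest, \<open>- n\<close>, for
  \<open>t = int q\<close>.\<close>

lemma line_op_nbr_sum:
  assumes "t = 0 \<or> t = int q"
  shows "line_op q t n (nbr_sum n q h) y = int n * (int q - t - 1) * line_op q t n h y"
proof -
  have "line_op q t n (nbr_sum n q h) y
      = (\<Sum>i<n. line_op q t n (line_sum q i h) y - line_op q t n h y)"
    unfolding nbr_sum_def by (simp only: line_op_sum line_op_diff)
  also have "\<dots> = (\<Sum>i<n. (int q - t - 1) * line_op q t n h y)"
    by (rule sum.cong) (auto simp: line_op_line_sum[OF assms] algebra_simps)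
  finally show ?thesis by simp
qed

section \<open>Line operators on words over the alphabet\<close>

lemma list_update_hamming_words:
  "y \<in> hamming_words n q \<Longrightarrow> a < q \<Longrightarrow> y[i := a] \<in> hamming_words n q"
  unfolding hamming_words_def using set_update_subset_insert[of y i a] by auto

lemma nth_hamming_words: "y \<in> hamming_words n q \<Longrightarrow> i < n \<Longrightarrow> y ! i < q"
  unfolding hamming_words_def by (auto dest: nth_mem)

lemma line_sum_cong:
  assumes "\<And>y. y \<in> hamming_words n q \<Longrightarrow> h y = h' y" and "y \<in> hamming_words n q"
  shows "line_sum q i h y = line_sum q i h' y"
  using assms by (auto simp: line_sum_def list_update_hamming_words intro!: sum.cong)

lemma line_op_cong:
  assumes "\<And>y. y \<in> hamming_words n q \<Longrightarrow> h y = h' y" and "y \<in> hamming_words n q"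
  shows "line_op q t k h y = line_op q t k h' y"
  using assms(2)
proof (induction k arbitrary: y)
  case (Suc k)
  then show ?case
    using line_sum_cong[of n q "line_op q t k h" "line_op q t k h'" y k] by simp
qed (simp add: assms(1))

text \<open>Every factor \<open>L\<^sub>i - t\<close> acts on \<open>g\<close> as the scalar
  \<open>- t\<close>, and a scalar multiple of \<open>g\<close> still has zero line sums.\<close>

lemma line_op_zero_line_sums:
  assumes "\<And>i y. i < k \<Longrightarrow> y \<in> hamming_words n q \<Longrightarrow> line_sum q i g y = 0"
    and "y \<in> hamming_words n q"
  shows "line_op q t k g y = (- t) ^ k * g y"
  using assms
proof (induction k arbitrary: y)
  case (Suc k)
  have IH: "line_op q t k g z = (- t) ^ k * g z" if "z \<in> hamming_words n q" for z
    using Suc that by simp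
  have "line_sum q k (line_op q t k g) y = line_sum q k (\<lambda>z. (- t) ^ k * g z) y"
    using IH Suc.prems(2) by (rule line_sum_cong)
  then show ?case
    using IH[OF Suc.prems(2)] Suc.prems by (simp add: line_sum_cmult)
qed simp

text \<open>Used in contrapositive form: if the total of \<open>h\<close> over all words is less
  than their number, then \<open>h\<close> is below 1 at some word.\<close>

lemma line_op_ge_power:
  assumes "\<And>y. y \<in> hamming_words n q \<Longrightarrow> h y \<ge> 1" and "y \<in> hamming_words n q"
  shows "line_op q 0 k h y \<ge> int q ^ k"
  using assms(2)
proof (induction k arbitrary: y)
  case (Suc k)
  have "(\<Sum>a<q. int q ^ k) \<le> (\<Sum>a<q. line_op q 0 k h (y[k := a]))"
    by (rule sum_mono) (simp add: Suc list_update_hamming_words)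
  then show ?case by (simp add: line_sum_def)
qed (simp add: assms(1))

lemma line_sum_ge:
  assumes "\<And>y. h y \<ge> 0" and "y \<in> hamming_words n q" and "i < n"
  shows "h y \<le> line_sum q i h y"
proof -
  have "h (y[i := y ! i]) \<le> line_sum q i h y"
    unfolding line_sum_def
    by (rule member_le_sum) (use assms nth_hamming_words in auto)
  then show ?thesis by simp
qed

lemma nbr_sum_nonneg:
  assumes "\<And>y. h y \<ge> 0" and "y \<in> hamming_words n q"
  shows "nbr_sum n q h y \<ge> 0"
  unfolding nbr_sum_def by (rule sum_nonneg) (use line_sum_ge[OF assms] in auto)

section \<open>Perfect codes\<close>

lemma hamming_arc_update:
  assumes "z \<in> hamming_words n q" and "i < n" and "a < q" and "a \<noteq> z ! i"
  shows "(z[i := a], z) \<in> parcs (hamming_graph n q)"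
proof -
  have "{k. k < n \<and> z[i := a] ! k \<noteq> z ! k} = {i}"
    using assms by (auto simp: nth_list_update hamming_words_def)
  then show ?thesis
    using assms by (auto simp: hamming_graph_def list_update_hamming_words)
qed

lemma hamming_arcE:
  assumes "(d, z) \<in> parcs (hamming_graph n q)"
  obtains i a where "i < n" "a < q" "a \<noteq> z ! i" "d = z[i := a]"
proof -
  from assms have W: "d \<in> hamming_words n q" "z \<in> hamming_words n q"
    and "card {k. k < n \<and> d ! k \<noteq> z ! k} = 1"
    by (auto simp: hamming_graph_def)
  then obtain i where i: "{k. k < n \<and> d ! k \<noteq> z ! k} = {i}"
    by (auto simp: card_1_singleton_iff)
  have "d ! k = z[i := d ! i] ! k" if "k < n" for k
    using i that W(2) by (cases "k = i") (auto simp: hamming_words_def)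
  then have "d = z[i := d ! i]"
    using W by (intro nth_equalityI) (auto simp: hamming_words_def)
  moreover have "i < n" "d ! i \<noteq> z ! i" using i by auto
  ultimately show thesis using that W(1) nth_hamming_words by metis
qed

lemma one_perfect_code_ex1:
  assumes "one_perfect_code (hamming_graph n q) D" and "z \<in> hamming_words n q"
  shows "\<exists>!d. d \<in> D \<and> (d = z \<or> (d, z) \<in> parcs (hamming_graph n q))"
proof -
  let ?G = "hamming_graph n q"
  have V: "pverts ?G = hamming_words n q" by (simp add: hamming_graph_def)
  have sub: "D \<subseteq> pverts ?G" and disj: "disjoint_family_on (graph_ball ?G 1) D"
    and cover: "(\<Union>c\<in>D. graph_ball ?G 1 c) = pverts ?G"
    using assms(1) by (auto simp: one_perfect_code_def)
  have ball: "z \<in> graph_ball ?G 1 d \<longleftrightarrow> d = z \<or> (d, z) \<in> parcs ?G" if "d \<in> D" for d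
    using graph_ball_1[of d ?G] that sub assms(2) V by auto
  obtain d where "d \<in> D" "z \<in> graph_ball ?G 1 d"
    using cover assms(2) V by blast
  moreover have "d' = d" if "d' \<in> D" "z \<in> graph_ball ?G 1 d'" for d'
    using disj that calculation unfolding disjoint_family_on_def by blast
  ultimately show ?thesis using ball by metis
qed

text \<open>Exactly one codeword lies in the ball around \<open>z\<close>: either \<open>z\<close>
  itself, and then no neighbour, or a single neighbour.\<close>

lemma one_perfect_code_nbr_sum:
  assumes "one_perfect_code (hamming_graph n q) D" and "z \<in> hamming_words n q"
  shows "nbr_sum n q (indicator D) z = 1 - indicator D z"
proof -
  let ?f = "indicator D :: nat list \<Rightarrow> int"
  obtain d where d: "d \<in> D" "d = z \<or> (d, z) \<in> parcs (hamming_graph n q)"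
    and uniq: "\<And>d'. d' \<in> D \<Longrightarrow> d' = z \<or> (d', z) \<in> parcs (hamming_graph n q) \<Longrightarrow> d' = d"
    using one_perfect_code_ex1[OF assms] by blast
  have len: "length z = n" using assms(2) by (simp add: hamming_words_def)
  have line: "line_sum q i ?f z - ?f z = (\<Sum>a\<in>{..<q} - {z ! i}. ?f (z[i := a]))" if "i < n" for i
    using that nth_hamming_words[OF assms(2)]
    by (simp add: line_sum_def sum.remove[of "{..<q}" "z ! i"])
  have code: "z[i := a] \<in> D \<longleftrightarrow> z[i := a] = d" if "i < n" "a < q" "a \<noteq> z ! i" for i a
    using uniq hamming_arc_update[OF assms(2) that] d(1) by blast
  show ?thesis
  proof (cases "d = z")
    case True
    have notin: "z[i := a] \<notin> D" if "i < n" "a < q" "a \<noteq> z ! i" for i a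
      using code[OF that] that True len by (metis nth_list_update_eq)
    have "nbr_sum n q ?f z = 0"
      unfolding nbr_sum_def by (intro sum.neutral) (auto simp: line notin intro!: sum.neutral)
    then show ?thesis using d(1) True by simp
  next
    case False
    then obtain j b where jb: "j < n" "b < q" "b \<noteq> z ! j" "d = z[j := b]"
      using d(2) hamming_arcE by metis
    \<comment> \<open>A neighbour of \<open>z\<close> determines the changed position and the new
      letter, so the codeword \<open>d\<close> is met on one line only, and once there.\<close>
    have code': "z[i := a] \<in> D \<longleftrightarrow> i = j \<and> a = b" if "i < n" "a < q" "a \<noteq> z ! i" for i a
      using code[OF that] that jb len by (metis nth_list_update_eq nth_list_update_neq)
    have "line_sum q i ?f z - ?f z = (if i = j then 1 else 0)" if "i < n" for i
    proof -
      have "(\<Sum>a\<in>{..<q} - {z ! i}. ?f (z[i := a]))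
          = (\<Sum>a\<in>{..<q} - {z ! i}. if a = b then (if i = j then 1 else 0) else 0)"
        by (rule sum.cong) (use code' that in \<open>auto simp: indicator_def\<close>)
      also have "\<dots> = (if i = j then 1 else 0)"
        using jb by simp
      finally show ?thesis using line[OF that] by simp
    qed
    then have "nbr_sum n q ?f z = 1"
      unfolding nbr_sum_def using jb(1) by simp
    moreover have "z \<notin> D" using uniq False by blast
    ultimately show ?thesis by simp
  qed
qed

section \<open>Puncturing\<close>

text \<open>The position in the full word of the \<open>i\<close>-th letter that remains after
  position \<open>j\<close> is deleted.\<close>

definition skip :: "nat \<Rightarrow> nat \<Rightarrow> nat" where
  "skip j i = (if i < j then i else Suc i)"

lemma bij_betw_skip: "j < n \<Longrightarrow> bij_betw (skip j) {..<n - 1} ({..<n} - {j})"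
  by (rule bij_betw_byWitness[where f' = "\<lambda>i. if i < j then i else i - 1"])
    (auto simp: skip_def)

lemma skipE:
  assumes "j < n" and "k < n" and "k \<noteq> j"
  obtains i where "i < n - 1" "k = skip j i"
proof -
  have "k \<in> skip j ` {..<n - 1}"
    using bij_betw_imp_surj_on[OF bij_betw_skip[OF assms(1)]] assms(2,3) by simp
  then show thesis using that by auto
qed

lemma length_puncture: "j < length y \<Longrightarrow> length (puncture j y) = length y - 1"
  by (simp add: puncture_def)

lemma nth_puncture:
  "j < length y \<Longrightarrow> i < length y - 1 \<Longrightarrow> puncture j y ! i = y ! skip j i"
  by (auto simp: puncture_def skip_def nth_append)

lemma puncture_hamming_words:
  assumes "y \<in> hamming_words n q" and "j < n"
  shows "puncture j y \<in> hamming_words (n - 1) q"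
  using assms set_take_subset[of j y] set_drop_subset[of "Suc j" y]
  by (auto simp: hamming_words_def length_puncture) (auto simp: puncture_def)

lemma puncture_update_same: "puncture j (y[j := a]) = puncture j y"
  by (simp add: puncture_def)

lemma puncture_update_skip:
  assumes "j < length y" and "i < length y - 1"
  shows "puncture j (y[skip j i := a]) = (puncture j y)[i := a]"
  using assms
  by (intro nth_equalityI)
    (auto simp: length_puncture nth_puncture nth_list_update skip_def split: if_splits)

lemma puncture_eq_imp_update:
  assumes "puncture j u = puncture j v" and "length u = length v" and "j < length v"
  shows "u[j := v ! j] = v"
proof (rule nth_equalityI)
  fix k assume "k < length (u[j := v ! j])"
  then have k: "k < length v" using assms(2) by simp
  show "u[j := v ! j] ! k = v ! k"
  proof (cases "k = j")
    case False
    with k obtain i where "i < length v - 1" "k = skip j i"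
      using skipE[OF assms(3)] by blast
    then show ?thesis
      using assms nth_puncture[of j u i] nth_puncture[of j v i] False by simp
  qed (use assms in simp)
qed (use assms in simp)

text \<open>Two codewords merged by deleting position \<open>j\<close> differ only there. Deleting
  another position instead keeps them distinct and adjacent, which is impossible in a
  \<open>1\<close>-perfect code.\<close>

lemma inj_on_puncture:
  assumes "extended_one_perfect_code n q C" and "n \<ge> 2" and "j < n"
  shows "inj_on (puncture j) C"
proof (rule inj_onI, rule ccontr)
  fix u v assume uv: "u \<in> C" "v \<in> C" "puncture j u = puncture j v" "u \<noteq> v"
  have W: "u \<in> hamming_words n q" "v \<in> hamming_words n q"
    using uv assms(1) by (auto simp: extended_one_perfect_code_def hamming_graph_def)
  then have len: "length u = n" "length v = n" by (auto simp: hamming_words_def)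
  have v: "v = u[j := v ! j]"
    using puncture_eq_imp_update[OF uv(3)] len assms(3) by simp
  define j' where "j' = (if j = 0 then 1 else 0 :: nat)"
  have j': "j' < n" "j' \<noteq> j" using assms(2,3) by (auto simp: j'_def)
  then obtain i where i: "i < n - 1" "j = skip j' i"
    using skipE[of j' n j] assms(3) by metis
  let ?u = "puncture j' u" and ?v = "puncture j' v"
  have upd: "?v = ?u[i := v ! j]"
    using puncture_update_skip[of j' u i "v ! j"] v i j' len by simp
  have "v ! j \<noteq> u ! j" using uv(4) v by (metis list_update_id)
  then have ne: "v ! j \<noteq> ?u ! i"
    using nth_puncture[of j' u i] i j' len by simp
  have "(?v, ?u) \<in> parcs (hamming_graph (n - 1) q)"
    unfolding upd using hamming_arc_update puncture_hamming_words[OF W(1) j'(1)] i(1) ne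
      nth_hamming_words[OF W(2) assms(3)] by blast
  moreover have "?v \<noteq> ?u"
    using ne upd i(1) length_puncture[of j' u] len j' by (metis nth_list_update_eq)
  moreover have "one_perfect_code (hamming_graph (n - 1) q) (puncture j' ` C)"
    using assms(1) j' by (simp add: extended_one_perfect_code_def)
  ultimately show False
    using one_perfect_code_ex1[OF _ puncture_hamming_words[OF W(1) j'(1)]] uv(1,2) by blast
qed

text \<open>The lines in direction \<open>j\<close> are the fibres of \<open>puncture j\<close>, and
  by injectivity each contains at most one codeword.\<close>

lemma line_sum_indicator_puncture:
  assumes "inj_on (puncture j) C" and "C \<subseteq> hamming_words n q" and "j < n"
    and "y \<in> hamming_words n q"
  shows "line_sum q j (indicator C) y = indicator (puncture j ` C) (puncture j y)"
proof -
  have len: "length y = n" using assms(4) by (simp add: hamming_words_def)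
  show ?thesis
  proof (cases "puncture j y \<in> puncture j ` C")
    case True
    then obtain c where c: "c \<in> C" "puncture j y = puncture j c" by auto
    have cW: "c \<in> hamming_words n q" using c(1) assms(2) by auto
    have yc: "y[j := c ! j] = c"
      using puncture_eq_imp_update[OF c(2)] cW len assms(3) by (simp add: hamming_words_def)
    have "y[j := a] \<in> C \<longleftrightarrow> a = c ! j" for a
    proof
      assume "y[j := a] \<in> C"
      then have "y[j := a] = c"
        using assms(1) c by (simp add: inj_on_def puncture_update_same)
      then show "a = c ! j" using len assms(3) by auto
    qed (use yc c(1) in simp)
    then have "line_sum q j (indicator C) y = (\<Sum>a<q. if a = c ! j then 1 else 0)"
      unfolding line_sum_def by (intro sum.cong) (auto simp: indicator_def)
    also have "\<dots> = 1" using nth_hamming_words[OF cW assms(3)] by simp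
    finally show ?thesis using True by simp
  next
    case False
    then have "y[j := a] \<notin> C" for a
      by (metis image_eqI puncture_update_same)
    then show ?thesis using False by (simp add: line_sum_def)
  qed
qed

text \<open>Direction \<open>j\<close> contributes \<open>(q - 1) L\<^sub>j f\<close>. The other
  directions form the adjacency operator of the punctured graph, where perfectness gives
  \<open>1 - L\<^sub>j f\<close>.\<close>

lemma line_sum_nbr_sum_code:
  assumes "extended_one_perfect_code n q C" and "n \<ge> 2" and "j < n" and "y \<in> hamming_words n q"
  shows "line_sum q j (nbr_sum n q (indicator C)) y = 1 + (int q - 2) * line_sum q j (indicator C) y"
proof -
  let ?f = "indicator C :: nat list \<Rightarrow> int"
  let ?f' = "indicator (puncture j ` C) :: nat list \<Rightarrow> int"
  have CW: "C \<subseteq> hamming_words n q"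
    using assms(1) by (simp add: extended_one_perfect_code_def hamming_graph_def)
  have len: "length y = n" using assms(4) by (simp add: hamming_words_def)
  note Lj = line_sum_indicator_puncture[OF inj_on_puncture[OF assms(1-3)] CW assms(3)]
  let ?d = "\<lambda>i. line_sum q j (line_sum q i ?f) y - line_sum q j ?f y"
  have d_skip: "?d (skip j i) = line_sum q i ?f' (puncture j y) - ?f' (puncture j y)"
    if "i < n - 1" for i
  proof -
    have "line_sum q (skip j i) (line_sum q j ?f) y
        = (\<Sum>a<q. ?f' (puncture j (y[skip j i := a])))"
      unfolding line_sum_def[of q "skip j i"]
      by (intro sum.cong) (auto simp: Lj list_update_hamming_words[OF assms(4)])
    also have "\<dots> = line_sum q i ?f' (puncture j y)"
      unfolding line_sum_def using that len assms(3) by (simp add: puncture_update_skip)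
    finally show ?thesis
      by (simp add: line_sum_commute[of q j] Lj[OF assms(4)])
  qed
  have "(\<Sum>i\<in>{..<n} - {j}. ?d i) = nbr_sum (n - 1) q ?f' (puncture j y)"
    unfolding nbr_sum_def
    by (subst sum.reindex_bij_betw[OF bij_betw_skip[OF assms(3)], symmetric])
      (simp add: d_skip)
  also have "\<dots> = 1 - line_sum q j ?f y"
    using one_perfect_code_nbr_sum puncture_hamming_words[OF assms(4,3)] assms(1,3)
    by (simp add: extended_one_perfect_code_def Lj[OF assms(4)])
  finally have rest: "(\<Sum>i\<in>{..<n} - {j}. ?d i) = 1 - line_sum q j ?f y" .
  have "line_sum q j (nbr_sum n q ?f) y = (\<Sum>i<n. ?d i)"
    unfolding nbr_sum_def by (simp only: line_sum_sum line_sum_diff)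
  also have "\<dots> = ?d j + (\<Sum>i\<in>{..<n} - {j}. ?d i)"
    using assms(3) by (simp add: sum.remove)
  finally show ?thesis
    by (simp add: rest line_sum_idem algebra_simps)
qed

section \<open>The two divisibility conditions\<close>

text \<open>The value of \<open>line_op\<close> here is the cardinality of \<open>C\<close>. The
  equation arises by summing the identity for \<open>L\<^sub>j (A f)\<close> with
  \<open>j = 0\<close> over all words.\<close>

lemma code_line_op_0:
  assumes "extended_one_perfect_code n q C" and "n \<ge> 2" and "y \<in> hamming_words n q"
  shows "int q * (1 + (int n - 1) * (int q - 1)) * line_op q 0 n (indicator C) y = int q ^ n"
proof -
  let ?f = "indicator C :: nat list \<Rightarrow> int"
  let ?S = "line_op q 0 n ?f y"
  have "line_op q 0 n (line_sum q 0 (nbr_sum n q ?f)) y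
      = line_op q 0 n (\<lambda>z. 1 + (int q - 2) * line_sum q 0 ?f z) y"
    by (rule line_op_cong[OF _ assms(3)])
      (use line_sum_nbr_sum_code[OF assms(1,2)] assms(2) in simp)
  then have "int q * (int n * (int q - 1) * ?S) = int q ^ n + (int q - 2) * (int q * ?S)"
    using assms(2)
    by (simp add: line_op_line_sum line_op_nbr_sum line_op_add line_op_cmult line_op_const)
  then show ?thesis by (simp add: algebra_simps)
qed

lemma sphere_size_dvd_power:
  assumes "extended_one_perfect_code n q C" and "n \<ge> 2" and "q > 0"
  shows "1 + (n - 1) * (q - 1) dvd q ^ n"
proof -
  have "replicate n 0 \<in> hamming_words n q" using assms(3) by (auto simp: hamming_words_def)
  from code_line_op_0[OF assms(1,2) this]
  have "1 + (int n - 1) * (int q - 1) dvd int q ^ n"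
    by (metis dvd_triv_left dvd_triv_right dvd_trans)
  then have "int (1 + (n - 1) * (q - 1)) dvd int (q ^ n)"
    using assms(2,3) by simp
  then show ?thesis by (simp only: int_dvd_int_iff)
qed

text \<open>An averaging argument: \<open>?h y\<close> counts the codewords in the ball of radius 1
  around \<open>y\<close>, and its total over all words is less than \<open>q ^ n\<close>. So some
  ball contains no codeword.\<close>

lemma ex_far_word:
  assumes "extended_one_perfect_code n q C" and "n \<ge> 2" and "q \<ge> 2"
  obtains y where "y \<in> hamming_words n q" "indicator C y = (0 :: int)"
    "nbr_sum n q (indicator C) y = 0"
proof -
  let ?f = "indicator C :: nat list \<Rightarrow> int"
  let ?h = "\<lambda>y. ?f y + nbr_sum n q ?f y"
  have W: "replicate n 0 \<in> hamming_words n q" using assms(3) by (auto simp: hamming_words_def)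
  let ?S = "line_op q 0 n ?f (replicate n 0)"
  let ?c = "int q * (1 + (int n - 1) * (int q - 1))"
  have eq: "?c * ?S = int q ^ n"
    by (rule code_line_op_0[OF assms(1,2) W])
  have c: "?c > 0" using assms(2,3) by (simp add: add_pos_nonneg)
  have S: "?S > 0"
    using eq c assms(3) zero_less_mult_pos[of ?c ?S] by simp
  \<comment> \<open>\<open>?c\<close> is the number of words per codeword, compared here with the
    size of a ball in \<open>H(n,q)\<close>.\<close>
  have "?c - (1 + int n * (int q - 1)) = (int q - 1) * (int q - 1) * (int n - 1)"
    by (simp add: algebra_simps)
  moreover have "(int q - 1) * (int q - 1) * (int n - 1) > 0"
    using assms(2,3) by (intro mult_pos_pos) simp_all
  ultimately have "1 + int n * (int q - 1) < ?c" by linarith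
  from mult_strict_right_mono[OF this S] have "(1 + int n * (int q - 1)) * ?S < int q ^ n"
    unfolding eq .
  moreover have "line_op q 0 n ?h (replicate n 0) = (1 + int n * (int q - 1)) * ?S"
    by (simp add: line_op_add line_op_nbr_sum algebra_simps)
  ultimately obtain y where y: "y \<in> hamming_words n q" "\<not> ?h y \<ge> 1"
    using line_op_ge_power[of n q ?h "replicate n 0" n] W by force
  moreover have "?f y \<ge> 0" "nbr_sum n q ?f y \<ge> 0"
    using nbr_sum_nonneg[OF _ y(1), of ?f] by simp_all
  ultimately show thesis by (intro that[of y]) linarith+
qed

text \<open>The number \<open>n + q - 2\<close> is the gap between \<open>q - 2\<close>, the
  coefficient in the identity for \<open>L\<^sub>j (A f)\<close>, and the eigenvalue
  \<open>- n\<close> of \<open>A\<close>.\<close>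

lemma eigenvalue_gap_dvd_power:
  assumes "extended_one_perfect_code n q C" and "n \<ge> 2" and "q \<ge> 2"
  shows "n + q - 2 dvd q ^ n"
proof -
  let ?f = "indicator C :: nat list \<Rightarrow> int"
  \<comment> \<open>The factor \<open>q\<close> makes the constant terms cancel in line sums,
    because \<open>L\<^sub>j\<close> maps the constant 1 to \<open>q\<close>.\<close>
  define g where "g = (\<lambda>y. 1 + int q * (int q - 2) * ?f y - int q * nbr_sum n q ?f y)"
  obtain y where y: "y \<in> hamming_words n q" "?f y = 0" "nbr_sum n q ?f y = 0"
    using ex_far_word[OF assms] .
  have "line_sum q j g z = 0" if "j < n" "z \<in> hamming_words n q" for j z
    unfolding g_def line_sum_diff line_sum_add line_sum_cmult line_sum_const
      line_sum_nbr_sum_code[OF assms(1,2) that]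
    by (simp add: algebra_simps)
  then have "line_op q (int q) n g y = (- int q) ^ n * g y"
    by (rule line_op_zero_line_sums[OF _ y(1)])
  \<comment> \<open>The constant 1 is annihilated because \<open>n > 0\<close>, and \<open>A\<close>
    acts as \<open>- n\<close>.\<close>
  moreover have "line_op q (int q) n g y = int q * (int n + int q - 2) * line_op q (int q) n ?f y"
    using assms(2) unfolding g_def line_op_diff line_op_add line_op_cmult line_op_const
    by (simp add: line_op_nbr_sum algebra_simps)
  ultimately have "(int n + int q - 2) * (int q * line_op q (int q) n ?f y) = (- int q) ^ n"
    using y by (simp add: g_def algebra_simps)
  then have "int n + int q - 2 dvd (- int q) ^ n" by (metis dvd_triv_left)
  then have "int (n + q - 2) dvd int (q ^ n)"
    using assms(2) by (cases "even n") simp_all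
  then show ?thesis by (simp only: int_dvd_int_iff)
qed

section \<open>The parameters\<close>

text \<open>Writing \<open>r = m + a\<close> and \<open>s = m + b\<close> and eliminating
  \<open>n\<close> gives \<open>p ^ b = p ^ a * (q - 1) + 2 - q\<close>. Modulo \<open>p\<close>
  this forces \<open>p = 2\<close>; if \<open>m > 1\<close>, then modulo 4 it forces
  \<open>a = 1\<close>, that is \<open>n = q + 2\<close>.\<close>

lemma parameters_from_powers:
  fixes p m q n r s :: nat
  assumes p: "prime p" and m: "m \<ge> 1" and q: "q = p ^ m" and n: "n > 2"
    and s: "1 + (n - 1) * (q - 1) = p ^ s" and r: "n + q - 2 = p ^ r"
  shows "(p = 2 \<and> m = 1 \<and> n = 2 ^ r \<and> r \<ge> 2) \<or> (p = 2 \<and> n = q + 2)"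
proof -
  have p2: "p \<ge> 2" using p by (rule prime_ge_2_nat)
  then have q2: "q \<ge> 2" unfolding q using m p2 self_le_power[of p m] by simp
  have "p ^ m < p ^ r" using r n q by simp
  then have mr: "m < r" using p2 by (simp add: power_strict_increasing_iff)
  define a where "a = r - m"
  have a: "a \<ge> 1" "r = m + a" using mr by (auto simp: a_def)
  have N: "n + q = q * p ^ a + 2" using r n q a(2) by (simp add: power_add)
  have "int (1 + (n - 1) * (q - 1)) = int q * (int (p ^ a) * (int q - 1) + 2 - int q)"
  proof -
    have n_eq: "int n = int q * int (p ^ a) + 2 - int q" using arg_cong[OF N, of int] by simp
    have "int (1 + (n - 1) * (q - 1)) = 1 + (int n - 1) * (int q - 1)"
      using n q2 by simp
    then show ?thesis unfolding n_eq by (simp add: algebra_simps)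
  qed
  then have eq: "int p ^ s = int q * (int p ^ a * (int q - 1) + 2 - int q)"
    unfolding s by simp
  have pa: "p ^ a \<ge> 2" using a(1) p2 self_le_power[of p a] by simp
  \<comment> \<open>This lower bound by \<open>q\<close> on the cofactor yields both
    \<open>m \<le> s\<close> and \<open>b \<ge> 1\<close>.\<close>
  have "int p ^ a * (int q - 1) \<ge> 2 * (int q - 1)"
    using pa q2 by (intro mult_right_mono) (simp_all flip: of_nat_power)
  then have ge: "int p ^ a * (int q - 1) + 2 - int q \<ge> int q" by simp
  have "int q ^ 1 \<le> int p ^ s"
    unfolding eq using ge q2 mult_left_mono[of 1 _ "int q"] by simp
  then have "m \<le> s" using q p2 by (simp flip: of_nat_power)
  then obtain b where b: "s = m + b" using le_Suc_ex by blast
  then have eqb: "int p ^ b = int p ^ a * (int q - 1) + 2 - int q"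
    using eq q p2 by (simp add: power_add)
  then have pb: "int p ^ b \<ge> int q" using ge by simp
  have b1: "b \<ge> 1"
    using pb q2 by (cases b) simp_all
  \<comment> \<open>The right-hand side equals 2 by \<open>eqb\<close>.\<close>
  have "int p dvd int p ^ b + int q - int p ^ a * (int q - 1)"
    using a b1 m q by (intro dvd_diff dvd_add dvd_mult2) (simp_all add: dvd_power)
  then have "int p dvd 2" using eqb by simp
  then have "p dvd 2" using int_dvd_int_iff[of p 2] by simp
  then have p_eq: "p = 2" using p2 dvd_imp_le[of p 2] by simp
  show ?thesis
  proof (cases "m = 1")
    case True
    have "2 ^ 1 < (2 :: nat) ^ r" using r n True q p_eq by simp
    then have "r \<ge> 2" using power_less_imp_less_exp[of "2::nat" 1 r] by simp
    then show ?thesis using True p_eq r q by simp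
  next
    case False
    then have q4: "4 dvd q" using m q p_eq le_imp_power_dvd[of 2 m "2::nat"] by simp
    have "a = 1"
    proof (rule ccontr)
      assume "a \<noteq> 1"
      then have "4 dvd (2 :: int) ^ a" using a(1) le_imp_power_dvd[of 2 a "2::int"] by simp
      then have "4 dvd 2 ^ a * (int q - 1) - int q" using q4 int_dvd_int_iff[of 4 q] by (intro dvd_diff) simp_all
      \<comment> \<open>Here \<open>2 ^ b\<close> is at least \<open>q\<close>, hence at least
        4.\<close>
      moreover have "b \<ge> 2"
        using pb b1 dvd_imp_le[OF q4] q2 p_eq by (cases "b = 1") simp_all
      then have "4 dvd (2 :: int) ^ b" using le_imp_power_dvd[of 2 b "2::int"] by simp
      ultimately have "4 dvd 2 ^ b - (2 ^ a * (int q - 1) - int q)" by (rule dvd_diff[rotated])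
      then have "(4 :: int) dvd 2" using eqb p_eq by simp
      then show False by simp
    qed
    then show ?thesis using N p_eq by simp
  qed
qed

theorem theorem2:
  fixes p m q n :: nat and C :: "nat list set"
  assumes "prime p" and "m \<ge> 1" and "q = p ^ m" and "n \<ge> 2"
    and "extended_one_perfect_code n q C"
  shows "n = 2
       \<or> (p = 2 \<and> m = 1 \<and> (\<exists>t::nat. t \<ge> 2 \<and> n = 2 ^ t))
       \<or> (p = 2 \<and> m \<ge> 1 \<and> n = q + 2)"
proof (cases "n = 2")
  case False
  then have n: "n > 2" using assms(4) by simp
  have "p \<ge> 2" using assms(1) by (rule prime_ge_2_nat)
  also have "p \<le> q" unfolding assms(3) using calculation assms(2) by (intro self_le_power) auto
  finally have q2: "q \<ge> 2" .
  have pow: "\<exists>s. d = p ^ s" if "d dvd q ^ n" for d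
    using that assms(1) unfolding assms(3) power_mult[symmetric]
    by (auto simp: divides_primepow_nat)
  obtain s where s: "1 + (n - 1) * (q - 1) = p ^ s"
    using pow sphere_size_dvd_power[OF assms(5,4)] q2 by force
  obtain r where r: "n + q - 2 = p ^ r"
    using pow eigenvalue_gap_dvd_power[OF assms(5,4) q2] by blast
  show ?thesis
    using parameters_from_powers[OF assms(1-3) n s r] assms(2) by blast
qed simp

end
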